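(* The collection of compact Hausdorff spaces together with (continuous) stochastic maps as morphisms forms a category, denoted $\mathbf{cHausStoch}$. In addition, the Dirac measure furnishes a faithful (but not full) functor $\delta:\mathbf{cHaus}\to\mathbf{cHausStoch}$ from the category of compact Hausdorff spaces and continuous maps, sending a space $X$ to $X$ and a continuous function $f:X\to Y$ to the stochastic map $\delta_f$ from $X$ to $Y$ given by $x\mapsto\delta_{f(x)}$.
   Context: For a compact Hausdorff space $Y$, $\mathcal{M}_Y$ is its Borel $\sigma$-algebra and $\mathrm{ProbMeas}(Y)$ is the set of regular Borel probability measures on $Y$ (outer regular by open sets and inner regular by compact sets on all Borel sets), with the vague topology: the coarsest topology making $\mu\mapsto\int_Y\varphi\,d\mu$ continuous for every continuous $\varphi:Y\to\mathbb{C}$. A (continuous) stochastic map from $X$ to $Y$ is a continuous function $\mu:X\to\mathrm{ProbMeas}(Y)$, with value at $x$ written $\mu_x$. The composite of $\mu$ from $X$ to $Y$ followed by $\nu$ from $Y$ to $Z$ is the stochastic map $\nu\circ\mu$ from $X$ to $Z$ with $(\nu\circ\mu)_x(E)=\int_Y\nu_y(E)\,d\mu_x(y)$ for $x\in X$, $E\in\mathcal{M}_Z$. The identity on $X$ is $x\mapsto\delta_x$, where $\delta_y$ denotes the Dirac measure at $y$: $\delta_y(E)=1$ if $y\in E$ and $0$ otherwise. *)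

theory Defs
  imports "HOL-Probability.Probability"
begin

section \<open>Categories and functors\<close>

text \<open>
  Hom-sets are indexed by objects, and morphisms with different (co)domains need not be
  distinct as HOL values. Identities, composition and the morphism part of a functor
  therefore take the objects involved as arguments:
  \<open>Comp C X Y Z f g\<close> is \<open>f : X \<rightarrow> Y\<close> followed by \<open>g : Y \<rightarrow> Z\<close>.
\<close>

record ('o, 'm) cat_data =
  Ob :: "'o set"
  Hom :: "'o \<Rightarrow> 'o \<Rightarrow> 'm set"
  Id :: "'o \<Rightarrow> 'm"
  Comp :: "'o \<Rightarrow> 'o \<Rightarrow> 'o \<Rightarrow> 'm \<Rightarrow> 'm \<Rightarrow> 'm"

locale category =
  fixes C :: "('o, 'm) cat_data"
  assumes Id_in_Hom: "X \<in> Ob C \<Longrightarrow> Id C X \<in> Hom C X X"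
    and Comp_in_Hom:
      "\<lbrakk>X \<in> Ob C; Y \<in> Ob C; Z \<in> Ob C; f \<in> Hom C X Y; g \<in> Hom C Y Z\<rbrakk>
        \<Longrightarrow> Comp C X Y Z f g \<in> Hom C X Z"
    and Comp_Id_left:
      "\<lbrakk>X \<in> Ob C; Y \<in> Ob C; f \<in> Hom C X Y\<rbrakk> \<Longrightarrow> Comp C X X Y (Id C X) f = f"
    and Comp_Id_right:
      "\<lbrakk>X \<in> Ob C; Y \<in> Ob C; f \<in> Hom C X Y\<rbrakk> \<Longrightarrow> Comp C X Y Y f (Id C Y) = f"
    and Comp_assoc:
      "\<lbrakk>W \<in> Ob C; X \<in> Ob C; Y \<in> Ob C; Z \<in> Ob C;
        f \<in> Hom C W X; g \<in> Hom C X Y; h \<in> Hom C Y Z\<rbrakk>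
        \<Longrightarrow> Comp C W Y Z (Comp C W X Y f g) h = Comp C W X Z f (Comp C X Y Z g h)"

locale category_functor = C: category C + D: category D
  for C :: "('o, 'm) cat_data" and D :: "('p, 'n) cat_data" +
  fixes F_ob :: "'o \<Rightarrow> 'p" and F_mor :: "'o \<Rightarrow> 'o \<Rightarrow> 'm \<Rightarrow> 'n"
  assumes F_ob_in_Ob: "X \<in> Ob C \<Longrightarrow> F_ob X \<in> Ob D"
    and F_mor_in_Hom:
      "\<lbrakk>X \<in> Ob C; Y \<in> Ob C; f \<in> Hom C X Y\<rbrakk> \<Longrightarrow> F_mor X Y f \<in> Hom D (F_ob X) (F_ob Y)"
    and F_mor_Id: "X \<in> Ob C \<Longrightarrow> F_mor X X (Id C X) = Id D (F_ob X)"
    and F_mor_Comp: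
      "\<lbrakk>X \<in> Ob C; Y \<in> Ob C; Z \<in> Ob C; f \<in> Hom C X Y; g \<in> Hom C Y Z\<rbrakk>
        \<Longrightarrow> F_mor X Z (Comp C X Y Z f g) =
            Comp D (F_ob X) (F_ob Y) (F_ob Z) (F_mor X Y f) (F_mor Y Z g)"

definition faithful_functor ::
  "('o, 'm) cat_data \<Rightarrow> ('p, 'n) cat_data \<Rightarrow> ('o \<Rightarrow> 'p) \<Rightarrow> ('o \<Rightarrow> 'o \<Rightarrow> 'm \<Rightarrow> 'n) \<Rightarrow> bool" where
  "faithful_functor C D F_ob F_mor \<longleftrightarrow>
    category_functor C D F_ob F_mor \<and>
    (\<forall>X\<in>Ob C. \<forall>Y\<in>Ob C. inj_on (F_mor X Y) (Hom C X Y))"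

definition full_functor ::
  "('o, 'm) cat_data \<Rightarrow> ('p, 'n) cat_data \<Rightarrow> ('o \<Rightarrow> 'p) \<Rightarrow> ('o \<Rightarrow> 'o \<Rightarrow> 'm \<Rightarrow> 'n) \<Rightarrow> bool" where
  "full_functor C D F_ob F_mor \<longleftrightarrow>
    category_functor C D F_ob F_mor \<and>
    (\<forall>X\<in>Ob C. \<forall>Y\<in>Ob C. F_mor X Y ` Hom C X Y = Hom D (F_ob X) (F_ob Y))"


section \<open>Regular Borel probability measures and stochastic maps\<close>

definition borel_on :: "'a topology \<Rightarrow> 'a measure" where
  "borel_on X = sigma (topspace X) {U. openin X U}"

definition prob_meas :: "'a topology \<Rightarrow> 'a measure set" where
  "prob_meas Y = {\<mu>. prob_space \<mu> \<and> sets \<mu> = sets (borel_on Y) \<and>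
     (\<forall>E\<in>sets \<mu>. emeasure \<mu> E = (INF U\<in>{U. openin Y U \<and> E \<subseteq> U}. emeasure \<mu> U)) \<and>
     (\<forall>E\<in>sets \<mu>. emeasure \<mu> E = (SUP K\<in>{K. compactin Y K \<and> K \<subseteq> E}. emeasure \<mu> K))}"

text \<open>
  The initial topology on \<^term>\<open>prob_meas Y\<close> for the maps integrating continuous complex
  functions; taking \<^term>\<open>V = (UNIV :: complex set)\<close> shows that its carrier is all of
  \<^term>\<open>prob_meas Y\<close>.
\<close>

definition vague_topology :: "'a topology \<Rightarrow> 'a measure topology" where
  "vague_topology Y = topology_generated_by
     {{\<mu> \<in> prob_meas Y. (\<integral>y. \<phi> y \<partial>\<mu>) \<in> V} | (\<phi> :: 'a \<Rightarrow> complex) V.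
        continuous_map Y euclidean \<phi> \<and> open V}"

text \<open>
  Maps out of \<open>X\<close> are required to be \<^const>\<open>undefined\<close> off \<^term>\<open>topspace X\<close>, so that equality
  of morphisms is equality on the points of \<open>X\<close>.
\<close>

definition stoch_maps :: "'a topology \<Rightarrow> 'b topology \<Rightarrow> ('a \<Rightarrow> 'b measure) set" where
  "stoch_maps X Y = {\<mu> \<in> extensional (topspace X). continuous_map X (vague_topology Y) \<mu>}"

text \<open>
  Both \<^const>\<open>measure_of\<close> (for a set function that is not a measure) and the Bochner integral
  (for a non-measurable integrand) default to \<open>0\<close>. Neither default can hide in a composite that
  is a stochastic map: the zero measure is not a probability measure, and if
  \<open>y \<mapsto> \<nu>\<^sub>y(E)\<close> were not measurable then \<open>E\<close> and its complement would both get mass \<open>0\<close>.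
\<close>

definition stoch_comp ::
  "'a topology \<Rightarrow> 'b topology \<Rightarrow> 'c topology \<Rightarrow>
    ('a \<Rightarrow> 'b measure) \<Rightarrow> ('b \<Rightarrow> 'c measure) \<Rightarrow> 'a \<Rightarrow> 'c measure" where
  "stoch_comp X Y Z \<mu> \<nu> =
    (\<lambda>x\<in>topspace X. measure_of (topspace Z) (sets (borel_on Z))
       (\<lambda>E. ennreal (\<integral>y. measure (\<nu> y) E \<partial>\<mu> x)))"

text \<open>\<^const>\<open>return\<close> is the Dirac measure.\<close>

definition dirac_map :: "'a topology \<Rightarrow> 'b topology \<Rightarrow> ('a \<Rightarrow> 'b) \<Rightarrow> 'a \<Rightarrow> 'b measure" where
  "dirac_map X Y f = (\<lambda>x\<in>topspace X. return (borel_on Y) (f x))"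


section \<open>The two categories\<close>

text \<open>
  The type \<open>'a\<close> plays the role of the universe: the objects are all compact Hausdorff spaces
  whose underlying set is a subset of \<open>'a\<close>, the empty space included.
\<close>

definition cHaus :: "('a topology, 'a \<Rightarrow> 'a) cat_data" where
  "cHaus = \<lparr>
     Ob = {X. compact_space X \<and> Hausdorff_space X},
     Hom = (\<lambda>X Y. {f \<in> extensional (topspace X). continuous_map X Y f}),
     Id = (\<lambda>X. \<lambda>x\<in>topspace X. x),
     Comp = (\<lambda>X Y Z f g. compose (topspace X) g f)\<rparr>"

definition cHausStoch :: "('a topology, 'a \<Rightarrow> 'a measure) cat_data" where
  "cHausStoch = \<lparr>
     Ob = {X. compact_space X \<and> Hausdorff_space X},
     Hom = stoch_maps,
     Id = (\<lambda>X. \<lambda>x\<in>topspace X. return (borel_on X) x),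
     Comp = stoch_comp\<rparr>"

end

theory Submission
  imports Defs
begin

text \<open>
  A continuous \<open>\<nu>\<close> is a Markov kernel, because \<open>y \<mapsto> \<nu>\<^sub>y(U)\<close> is lower semicontinuous for open \<open>U\<close>
  by inner regularity and Urysohn's lemma. Composition is therefore the bind of the Giry monad,
  which yields the unit and associativity laws. What remains is that a composite is again regular,
  although \<open>Y\<close> and \<open>Z\<close> need not be metrizable. For open \<open>U\<close>, normality of \<open>Z\<close> makes \<open>\<nu>\<^sub>y(U)\<close> the
  directed supremum of \<open>\<nu>\<^sub>y(V)\<close> over the open \<open>V\<close> with closure in \<open>U\<close>, and regularity of \<open>\<mu>\<^sub>x\<close> lets
  the integral pass through this uncountable supremum; inner regularity on open sets then implies
  regularity. Dirac measures separate points, and a fair coin on two points is a stochastic map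
  out of a point that is not a Dirac measure.
\<close>

section \<open>Borel sets and regular measures\<close>

lemma space_borel_on [simp]: "space (borel_on X) = topspace X"
  by (simp add: borel_on_def space_measure_of_conv)

lemma sets_borel_on: "sets (borel_on X) = sigma_sets (topspace X) {U. openin X U}"
  unfolding borel_on_def by (rule sets_measure_of) (auto dest: openin_subset)

lemma openin_imp_sets_borel_on: "openin X U \<Longrightarrow> U \<in> sets (borel_on X)"
  by (auto simp: sets_borel_on)

lemma closedin_imp_sets_borel_on:
  assumes "closedin X C"
  shows "C \<in> sets (borel_on X)"
proof -
  have "space (borel_on X) - (topspace X - C) \<in> sets (borel_on X)"
    using assms by (intro sets.compl_sets openin_imp_sets_borel_on) auto
  moreover have "topspace X - (topspace X - C) = C"
    using closedin_subset[OF assms] by auto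
  ultimately show ?thesis by simp
qed

lemma compactin_imp_sets_borel_on:
  "Hausdorff_space X \<Longrightarrow> compactin X K \<Longrightarrow> K \<in> sets (borel_on X)"
  by (simp add: closedin_imp_sets_borel_on compactin_imp_closedin)

lemma continuous_map_imp_borel_measurable:
  fixes f :: "'a \<Rightarrow> 'b::topological_space"
  assumes "continuous_map X euclidean f"
  shows "f \<in> borel_measurable (borel_on X)"
proof (rule borel_measurableI)
  fix S :: "'b set" assume "open S"
  then have "openin X {x \<in> topspace X. f x \<in> S}"
    using assms by (intro openin_continuous_map_preimage) auto
  moreover have "f -` S \<inter> space (borel_on X) = {x \<in> topspace X. f x \<in> S}"
    by auto
  ultimately show "f -` S \<inter> space (borel_on X) \<in> sets (borel_on X)"
    by (simp add: openin_imp_sets_borel_on)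
qed

lemma continuous_map_euclidean_compose:
  assumes "continuous_map X euclidean f" "continuous_on UNIV g"
  shows "continuous_map X euclidean (\<lambda>x. g (f x))"
  using continuous_map_compose[OF assms(1), of euclidean g] assms(2) by (simp add: o_def)

lemma continuous_map_imp_norm_bounded:
  fixes f :: "'a \<Rightarrow> 'b::real_normed_vector"
  assumes "compact_space X" "continuous_map X euclidean f"
  obtains B where "\<And>x. x \<in> topspace X \<Longrightarrow> norm (f x) \<le> B"
proof -
  have "compactin euclidean (f ` topspace X)"
    using assms image_compactin compact_space_def by blast
  then have "bounded (f ` topspace X)"
    by (simp add: compact_imp_bounded)
  then show thesis
    using that by (auto simp: bounded_iff)
qed

section \<open>Regular probability measures and criteria for regularity\<close>

lemma prob_measD:
  assumes "\<mu> \<in> prob_meas Y"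
  shows "prob_space \<mu>" "sets \<mu> = sets (borel_on Y)" "space \<mu> = topspace Y"
    "measurable \<mu> = measurable (borel_on Y)"
proof -
  show 1: "prob_space \<mu>" "sets \<mu> = sets (borel_on Y)"
    using assms by (auto simp: prob_meas_def)
  show "space \<mu> = topspace Y"
    using sets_eq_imp_space_eq[OF 1(2)] by simp
  show "measurable \<mu> = measurable (borel_on Y)"
    using 1(2) by (intro ext measurable_cong_sets) auto
qed

lemma prob_meas_inner_regular:
  assumes "\<mu> \<in> prob_meas Y" "E \<in> sets (borel_on Y)" "c < measure \<mu> E"
  obtains K where "compactin Y K" "K \<subseteq> E" "c < measure \<mu> K"
\<comment> \<open>\<open>ennreal\<close> sends negative numbers to 0, so for negative
  \<open>c\<close> the strict inequality need not survive the passage to \<open>emeasure\<close>.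
  There the empty set already serves as \<open>K\<close>.\<close>
proof (cases "c < 0")
  case True
  then show thesis using that[of "{}"] by auto
next
  case False
  interpret prob_space \<mu> using assms by (auto dest: prob_measD)
  have "ennreal c < emeasure \<mu> E"
    using assms(3) False by (simp add: emeasure_eq_measure ennreal_less_iff)
  also have "\<dots> = (SUP K\<in>{K. compactin Y K \<and> K \<subseteq> E}. emeasure \<mu> K)"
  proof -
    have "\<forall>E\<in>sets \<mu>. emeasure \<mu> E = (SUP K\<in>{K. compactin Y K \<and> K \<subseteq> E}. emeasure \<mu> K)"
      using assms(1) unfolding prob_meas_def by blast
    then show ?thesis using assms(2) prob_measD(2)[OF assms(1)] by blast
  qed
  finally obtain K where "compactin Y K" "K \<subseteq> E" "ennreal c < emeasure \<mu> K"
    by (auto simp: less_SUP_iff)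
  then show thesis
    using that[of K] False by (auto simp: emeasure_eq_measure ennreal_less_iff)
qed

lemma integrable_continuous_map:
  fixes f :: "'a \<Rightarrow> 'b::{banach, second_countable_topology}"
  assumes "compact_space Y" "\<mu> \<in> prob_meas Y" "continuous_map Y euclidean f"
  shows "integrable \<mu> f"
proof -
  interpret prob_space \<mu> using assms by (auto dest: prob_measD)
  obtain B where "\<And>x. x \<in> topspace Y \<Longrightarrow> norm (f x) \<le> B"
    using continuous_map_imp_norm_bounded assms by blast
  then show ?thesis
    using assms
    by (intro integrable_const_bound[where B = B])
       (auto simp: prob_measD[OF assms(2)] intro: continuous_map_imp_borel_measurable)
qed

text \<open>A closed-open squeeze of \<open>E\<close> gives both regularity conditions at once:
  \<open>U\<close> approximates from outside, and \<open>C\<close> is compact because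
  \<open>Z\<close> is, so it approximates from inside. The squeeze is a condition that induction
  over the generation of the Borel sets can handle.\<close>

lemma prob_measI_approx:
  assumes CH: "compact_space Z" "Hausdorff_space Z"
    and \<rho>: "prob_space \<rho>" "sets \<rho> = sets (borel_on Z)"
    and approx: "\<And>E e. E \<in> sets (borel_on Z) \<Longrightarrow> e > 0 \<Longrightarrow>
      \<exists>C U. closedin Z C \<and> openin Z U \<and> C \<subseteq> E \<and> E \<subseteq> U \<and> measure \<rho> (U - C) < e"
  shows "\<rho> \<in> prob_meas Z"
proof -
  interpret prob_space \<rho> by fact
  have outer: "emeasure \<rho> E = (INF U\<in>{U. openin Z U \<and> E \<subseteq> U}. emeasure \<rho> U)"
    and inner: "emeasure \<rho> E = (SUP K\<in>{K. compactin Z K \<and> K \<subseteq> E}. emeasure \<rho> K)"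
    if E: "E \<in> sets \<rho>" for E
  proof -
    have *: "\<exists>K U. compactin Z K \<and> openin Z U \<and> K \<subseteq> E \<and> E \<subseteq> U \<and>
        emeasure \<rho> U \<le> emeasure \<rho> E + ennreal e \<and> emeasure \<rho> E \<le> emeasure \<rho> K + ennreal e"
      if "e > 0" for e
    proof -
      obtain C U where CU: "closedin Z C" "openin Z U" "C \<subseteq> E" "E \<subseteq> U" "measure \<rho> (U - C) < e"
        using approx[OF E[unfolded \<rho>(2)] \<open>e > 0\<close>] by blast
      have sets: "C \<in> sets \<rho>" "U \<in> sets \<rho>"
        using CU by (auto simp: \<rho> closedin_imp_sets_borel_on openin_imp_sets_borel_on)
      have "measure \<rho> (U - C) = measure \<rho> U - measure \<rho> C"
        using CU sets by (intro finite_measure_Diff) auto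
      moreover have "measure \<rho> C \<le> measure \<rho> E" "measure \<rho> E \<le> measure \<rho> U"
        using CU sets E by (auto intro: finite_measure_mono)
      ultimately have "measure \<rho> U \<le> measure \<rho> E + e" "measure \<rho> E \<le> measure \<rho> C + e"
        using CU by auto
      then have "emeasure \<rho> U \<le> emeasure \<rho> E + ennreal e" "emeasure \<rho> E \<le> emeasure \<rho> C + ennreal e"
        using \<open>e > 0\<close> by (auto simp: emeasure_eq_measure simp flip: ennreal_plus)
      then show ?thesis
        using CU closedin_compact_space[OF CH(1)] by blast
    qed
    show "emeasure \<rho> E = (INF U\<in>{U. openin Z U \<and> E \<subseteq> U}. emeasure \<rho> U)"
    proof (rule antisym)
      show "emeasure \<rho> E \<le> (INF U\<in>{U. openin Z U \<and> E \<subseteq> U}. emeasure \<rho> U)"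
        by (rule INF_greatest) (auto intro!: emeasure_mono simp: \<rho> openin_imp_sets_borel_on)
      show "(INF U\<in>{U. openin Z U \<and> E \<subseteq> U}. emeasure \<rho> U) \<le> emeasure \<rho> E"
      proof (rule ennreal_le_epsilon)
        fix e :: real assume "e > 0"
        then obtain U where "openin Z U" "E \<subseteq> U" "emeasure \<rho> U \<le> emeasure \<rho> E + ennreal e"
          using * by blast
        then show "(INF U\<in>{U. openin Z U \<and> E \<subseteq> U}. emeasure \<rho> U) \<le> emeasure \<rho> E + ennreal e"
          by (intro INF_lower2[of U]) auto
      qed
    qed
    show "emeasure \<rho> E = (SUP K\<in>{K. compactin Z K \<and> K \<subseteq> E}. emeasure \<rho> K)"
    proof (rule antisym)
      show "(SUP K\<in>{K. compactin Z K \<and> K \<subseteq> E}. emeasure \<rho> K) \<le> emeasure \<rho> E"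
        by (rule SUP_least) (auto intro!: emeasure_mono simp: E)
      show "emeasure \<rho> E \<le> (SUP K\<in>{K. compactin Z K \<and> K \<subseteq> E}. emeasure \<rho> K)"
      proof (rule ennreal_le_epsilon)
        fix e :: real assume "e > 0"
        then obtain K where K: "compactin Z K" "K \<subseteq> E" "emeasure \<rho> E \<le> emeasure \<rho> K + ennreal e"
          using * by blast
        note K(3)
        also have "emeasure \<rho> K + ennreal e
            \<le> (SUP K\<in>{K. compactin Z K \<and> K \<subseteq> E}. emeasure \<rho> K) + ennreal e"
          using K by (intro add_right_mono SUP_upper) auto
        finally show "emeasure \<rho> E
            \<le> (SUP K\<in>{K. compactin Z K \<and> K \<subseteq> E}. emeasure \<rho> K) + ennreal e" .
      qed
    qed
  qed
  show ?thesis
    unfolding prob_meas_def using \<rho> outer inner by blast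
qed

text \<open>The Borel sets that can be squeezed between closed and open sets form a \<open>\<sigma>\<close>-algebra.\<close>

lemma prob_measI_inner_open:
  assumes CH: "compact_space Z" "Hausdorff_space Z"
    and \<rho>: "prob_space \<rho>" "sets \<rho> = sets (borel_on Z)"
    and inner: "\<And>U e. openin Z U \<Longrightarrow> e > 0 \<Longrightarrow>
      \<exists>C. closedin Z C \<and> C \<subseteq> U \<and> measure \<rho> U - e < measure \<rho> C"
  shows "\<rho> \<in> prob_meas Z"
proof (rule prob_measI_approx[OF CH \<rho>])
  interpret prob_space \<rho> by fact
  have closed_sets: "C \<in> sets \<rho>" if "closedin Z C" for C
    using that by (simp add: \<rho> closedin_imp_sets_borel_on)
  have open_sets: "U \<in> sets \<rho>" if "openin Z U" for U
    using that by (simp add: \<rho> openin_imp_sets_borel_on)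
  fix E and e :: real
  assume "E \<in> sets (borel_on Z)" and "e > 0"
  then have "E \<in> sigma_sets (topspace Z) {U. openin Z U}" by (simp add: sets_borel_on)
  from this \<open>e > 0\<close>
  show "\<exists>C U. closedin Z C \<and> openin Z U \<and> C \<subseteq> E \<and> E \<subseteq> U \<and> measure \<rho> (U - C) < e"
  proof (induction arbitrary: e)
    case (Basic U)
    then have "openin Z U" by simp
    then obtain C where C: "closedin Z C" "C \<subseteq> U" "measure \<rho> U - e < measure \<rho> C"
      using inner \<open>e > 0\<close> by blast
    moreover have "measure \<rho> (U - C) = measure \<rho> U - measure \<rho> C"
      using C \<open>openin Z U\<close> by (intro finite_measure_Diff closed_sets open_sets) auto
    ultimately have "measure \<rho> (U - C) < e" by linarith
    then show ?case using C \<open>openin Z U\<close> by blast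
  next
    case Empty
    then show ?case by (intro exI[of _ "{}"]) auto
  next
    case (Compl A)
    from Compl.IH[OF Compl.prems] obtain C U
      where CU: "closedin Z C" "openin Z U" "C \<subseteq> A" "A \<subseteq> U" "measure \<rho> (U - C) < e"
      by blast
    \<comment> \<open>Complements exchange the roles of the closed and the open set and leave the
      gap between them unchanged.\<close>
    have "(topspace Z - C) - (topspace Z - U) = U - C"
      using openin_subset[OF CU(2)] by auto
    then have "measure \<rho> ((topspace Z - C) - (topspace Z - U)) < e"
      using CU(5) by simp
    then show ?case
      using CU(1-4) by (intro exI[of _ "topspace Z - U"] exI[of _ "topspace Z - C"]) blast
  next
    case (Union A)
    have "\<exists>C U. closedin Z C \<and> openin Z U \<and> C \<subseteq> A i \<and> A i \<subseteq> U \<and>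
        measure \<rho> (U - C) < (e / 2) * (1 / 2) ^ Suc i" for i
      using Union.IH[of "(e / 2) * (1 / 2) ^ Suc i" i] Union.prems by simp
    then obtain C U where CU: "closedin Z (C i)" "openin Z (U i)" "C i \<subseteq> A i" "A i \<subseteq> U i"
        and less: "measure \<rho> (U i - C i) < (e / 2) * (1 / 2) ^ Suc i" for i
      by metis
    \<comment> \<open>The union of all \<open>C i\<close> need not be closed, so only finitely many
      are removed from the open union. The sets \<open>D n\<close> decrease to a set of measure at
      most \<open>e / 2\<close>, since the gaps are bounded by a geometric series with that sum. By
      continuity from above, some \<open>D n\<close> then has measure below
      \<open>e\<close>.\<close>
    define D where "D n = (\<Union>i. U i) - (\<Union>i<n. C i)" for n
    have openU: "openin Z (\<Union>i. U i)" using CU by auto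
    have closedC: "closedin Z (\<Union>i<n. C i)" for n
      using CU by (intro closedin_Union) auto
    have D_sets: "range D \<subseteq> sets \<rho>"
      unfolding D_def using openU closedC by (auto intro!: sets.Diff closed_sets open_sets)
    have sm: "(\<lambda>i. (e / 2) * (1 / 2) ^ Suc i) sums (e / 2)"
      using sums_mult[OF power_half_series, of "e / 2"] by simp
    have sm': "summable (\<lambda>i. measure \<rho> (U i - C i))"
      using less by (intro summable_comparison_test'[OF sums_summable[OF sm], of 0])
        (auto intro: less_imp_le)
    have "(\<Inter>n. D n) \<subseteq> (\<Union>i. U i - C i)"
      unfolding D_def by (blast intro: lessI)
    then have "measure \<rho> (\<Inter>n. D n) \<le> measure \<rho> (\<Union>i. U i - C i)"
      using CU by (intro finite_measure_mono sets.countable_UN) (auto intro!: closed_sets open_sets)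
    also have "\<dots> \<le> (\<Sum>i. measure \<rho> (U i - C i))"
      using CU sm' by (intro finite_measure_subadditive_countably) (auto intro!: closed_sets open_sets)
    also have "\<dots> \<le> (\<Sum>i. (e / 2) * (1 / 2) ^ Suc i)"
      using less sm' sm by (intro suminf_le) (auto intro: less_imp_le dest: sums_summable)
    also have "\<dots> < e"
      using sums_unique[OF sm] Union.prems by simp
    finally have lim_less: "measure \<rho> (\<Inter>n. D n) < e" .
    have "decseq D"
      unfolding D_def decseq_def by (auto intro: less_le_trans)
    then have "(\<lambda>n. measure \<rho> (D n)) \<longlonglongrightarrow> measure \<rho> (\<Inter>n. D n)"
      using D_sets by (intro finite_Lim_measure_decseq)
    from order_tendstoD(2)[OF this lim_less] obtain n where "measure \<rho> (D n) < e"
      by (auto simp: eventually_sequentially)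
    then show ?case
      using openU closedC[of n] CU(3,4) unfolding D_def
      by (intro exI[of _ "\<Union>i<n. C i"] exI[of _ "\<Union>i. U i"]) blast
  qed
qed

section \<open>Integrals of directed suprema of lower semicontinuous functions\<close>

text \<open>Upper half of a discrete layer-cake estimate: \<open>x\<close> is compared with the
  number of levels \<open>k\<close> in \<open>{1..n}\<close> that it strictly exceeds, and every
  such level is at most the floor of \<open>x\<close>.\<close>

lemma card_less_le:
  assumes "0 \<le> x"
  shows "real (card {k \<in> {1..n}. real k < x}) \<le> x"
proof -
  have "card {k \<in> {1..n}. real k < x} \<le> card {1..nat \<lfloor>x\<rfloor>}"
    by (rule card_mono) (auto simp: le_nat_floor)
  then show ?thesis using assms by simp linarith
qed

text \<open>Lower half of the estimate: the integers from 1 to \<open>ceiling x - 1\<close> lie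
  strictly below \<open>x\<close>, and \<open>x <= n\<close> keeps them inside
  \<open>{1..n}\<close>. Rounding costs at most one unit.\<close>

lemma le_Suc_card_less:
  assumes "x \<le> real n"
  shows "x \<le> real (card {k \<in> {1..n}. real k < x}) + 1"
proof -
  have "{1..nat (\<lceil>x\<rceil> - 1)} \<subseteq> {k \<in> {1..n}. real k < x}"
    using assms by (auto simp: le_nat_iff) linarith+
  then have "card {1..nat (\<lceil>x\<rceil> - 1)} \<le> card {k \<in> {1..n}. real k < x}"
    by (intro card_mono) auto
  then show ?thesis by simp linarith
qed

text \<open>
  By the layer-cake formula it is enough to treat finitely many superlevel sets
  of the supremum, and each is exhausted up to \<open>e\<close> by a compact set, on which finitely many
  members of the family suffice.
\<close>

lemma prob_meas_directed_sup:
  fixes F :: "'i \<Rightarrow> 'a \<Rightarrow> real" and g :: "'a \<Rightarrow> real"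
  assumes \<mu>: "\<mu> \<in> prob_meas Y" and haus: "Hausdorff_space Y"
    and I: "I \<noteq> {}"
    and directed: "\<And>i j. i \<in> I \<Longrightarrow> j \<in> I \<Longrightarrow>
      \<exists>k\<in>I. \<forall>y\<in>topspace Y. F i y \<le> F k y \<and> F j y \<le> F k y"
    and lsc: "\<And>i c. i \<in> I \<Longrightarrow> openin Y {y \<in> topspace Y. c < F i y}"
    and nonneg: "\<And>i y. i \<in> I \<Longrightarrow> y \<in> topspace Y \<Longrightarrow> 0 \<le> F i y"
    and le: "\<And>i y. i \<in> I \<Longrightarrow> y \<in> topspace Y \<Longrightarrow> F i y \<le> g y"
    and g_le: "\<And>y. y \<in> topspace Y \<Longrightarrow> g y \<le> 1"
    and sup: "\<And>y c. y \<in> topspace Y \<Longrightarrow> c < g y \<Longrightarrow> \<exists>i\<in>I. c < F i y"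
    and e: "e > 0"
  shows "\<exists>i\<in>I. (\<integral>y. g y \<partial>\<mu>) - e < (\<integral>y. F i y \<partial>\<mu>)"
proof -
  interpret prob_space \<mu> using \<mu> by (rule prob_measD)
  note \<mu>D = prob_measD[OF \<mu>]
  have g_nonneg: "0 \<le> g y" if "y \<in> topspace Y" for y
    using I nonneg le that by (meson ex_in_conv order_trans)
  \<comment> \<open>By \<open>le\<close> and \<open>sup\<close>, \<open>g\<close> is the pointwise
    supremum of the family. Its superlevel sets are thus unions of open sets, which makes
    \<open>g\<close> measurable even when \<open>I\<close> is uncountable.\<close>
  have G_eq: "{y \<in> topspace Y. c < g y} = (\<Union>i\<in>I. {y \<in> topspace Y. c < F i y})" for c
    using le sup by (auto intro: less_le_trans)
  have G_open: "openin Y {y \<in> topspace Y. c < g y}" for c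
    unfolding G_eq using lsc by auto
  have g_meas: "g \<in> borel_measurable \<mu>"
    unfolding \<mu>D(4) by (rule borel_measurableI_greater) (simp add: openin_imp_sets_borel_on G_open)
  have F_meas: "F i \<in> borel_measurable \<mu>" if "i \<in> I" for i
    unfolding \<mu>D(4) by (rule borel_measurableI_greater) (simp add: openin_imp_sets_borel_on lsc that)
  have g_int: "integrable \<mu> g"
    using g_meas g_nonneg g_le by (intro integrable_const_bound[where B = 1]) (auto simp: \<mu>D)
  have F_int: "integrable \<mu> (F i)" if "i \<in> I" for i
    using F_meas nonneg that le g_le
    by (intro integrable_const_bound[where B = 1]) (force simp: \<mu>D)+
  have finite_directed: "\<exists>k\<in>I. \<forall>j\<in>J. \<forall>y\<in>topspace Y. F j y \<le> F k y" if "finite J" "J \<subseteq> I" for J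
    using that
  proof (induction rule: finite_induct)
    case empty
    then show ?case using I by auto
  next
    case (insert j J)
    then obtain k where k: "k \<in> I" "\<forall>j\<in>J. \<forall>y\<in>topspace Y. F j y \<le> F k y" by auto
    from directed[OF k(1), of j] insert obtain l where
      "l \<in> I" "\<forall>y\<in>topspace Y. F k y \<le> F l y \<and> F j y \<le> F l y" by auto
    then show ?case using k(2) by (intro bexI[of _ l]) (auto intro: order_trans)
  qed
  \<comment> \<open>The open superlevel sets of the \<open>F i\<close> cover \<open>K\<close>. A
    finite subcover involves finitely many indices, and directedness bounds these by a single
    one.\<close>
  have compact_step: "\<exists>i\<in>I. \<forall>y\<in>K. c < F i y" if K: "compactin Y K" "\<And>y. y \<in> K \<Longrightarrow> c < g y" for K c
  proof -
    have "K \<subseteq> topspace Y" using K compactin_subset_topspace by blast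
    then have "K \<subseteq> \<Union> ((\<lambda>i. {y \<in> topspace Y. c < F i y}) ` I)"
      using K(2) G_eq[of c] by blast
    then have "\<exists>\<F>. finite \<F> \<and> \<F> \<subseteq> (\<lambda>i. {y \<in> topspace Y. c < F i y}) ` I \<and> K \<subseteq> \<Union>\<F>"
      using lsc by (intro compactinD[OF K(1)]) auto
    then obtain \<F> where \<F>: "finite \<F>" "\<F> \<subseteq> (\<lambda>i. {y \<in> topspace Y. c < F i y}) ` I" "K \<subseteq> \<Union>\<F>"
      by (elim exE conjE)
    from finite_subset_image[OF \<F>(1,2)] obtain J
      where J: "J \<subseteq> I" "finite J" "\<F> = (\<lambda>i. {y \<in> topspace Y. c < F i y}) ` J"
      by (elim exE conjE)
    then obtain k where "k \<in> I" "\<forall>j\<in>J. \<forall>y\<in>topspace Y. F j y \<le> F k y"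
      using finite_directed by blast
    moreover have "\<exists>j\<in>J. y \<in> topspace Y \<and> c < F j y" if "y \<in> K" for y
      using that \<F>(3) J(3) by auto
    ultimately show ?thesis by (meson less_le_trans)
  qed
  \<comment> \<open>The error \<open>e\<close> is shared: \<open>1 / n\<close> for rounding
    \<open>g\<close> to \<open>n\<close> levels, and \<open>e / 2\<close> for replacing the
    superlevel sets by compact sets.\<close>
  obtain n :: nat where n: "n > 0" "1 / real n < e / 2"
    using e by (metis half_gt_zero nat_approx_posE zero_less_Suc)
  define G where "G k = {y \<in> topspace Y. real k < real n * g y}" for k :: nat
  have G_alt: "G k = {y \<in> topspace Y. real k / real n < g y}" for k
    using n by (auto simp: G_def field_simps)
  have G_sets: "G k \<in> sets \<mu>" for k
    unfolding G_alt \<mu>D(2) by (intro openin_imp_sets_borel_on G_open)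
  have "\<exists>K. compactin Y K \<and> K \<subseteq> G k \<and> measure \<mu> (G k) - e / 2 < measure \<mu> K" for k
    by (rule prob_meas_inner_regular[OF \<mu>, of "G k" "measure \<mu> (G k) - e / 2"])
       (use G_sets e in \<open>auto simp: \<mu>D\<close>)
  then obtain K where K: "compactin Y (K k)" "K k \<subseteq> G k" "measure \<mu> (G k) - e / 2 < measure \<mu> (K k)" for k
    by metis
  have K_sets: "K k \<in> sets \<mu>" for k
    using K(1) haus by (simp add: \<mu>D compactin_imp_sets_borel_on)
  have "\<exists>i\<in>I. \<forall>y\<in>K k. real k / real n < F i y" for k
    using K(2)[of k] by (intro compact_step K(1)) (auto simp: G_alt)
  then obtain i where i: "i k \<in> I" "\<And>y. y \<in> K k \<Longrightarrow> real k / real n < F (i k) y" for k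
    by metis
  \<comment> \<open>One index \<open>l\<close> now works for all \<open>n\<close> levels
    simultaneously.\<close>
  have "\<exists>l\<in>I. \<forall>j\<in>i ` {1..n}. \<forall>y\<in>topspace Y. F j y \<le> F l y"
    using i(1) by (intro finite_directed) auto
  then obtain l where l: "l \<in> I" "\<And>k y. k \<in> {1..n} \<Longrightarrow> y \<in> topspace Y \<Longrightarrow> F (i k) y \<le> F l y"
    by blast
  have K_F: "real k < real n * F l y" if "k \<in> {1..n}" "y \<in> K k" for k y
  proof -
    have "y \<in> topspace Y" using that K(1) compactin_subset_topspace by blast
    then have "real k / real n < F l y" using i(2)[OF that(2)] l(2)[OF that(1)] by force
    then show ?thesis using n by (simp add: field_simps)
  qed
  \<comment> \<open>The sum of indicators counts the levels below \<open>n * g y\<close>, so it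
    falls short of \<open>n * g y\<close> by at most 1.\<close>
  have "real n * (\<integral>y. g y \<partial>\<mu>) \<le> (\<integral>y. (\<Sum>k\<in>{1..n}. indicator (G k) y) + 1 \<partial>\<mu>)"
  proof -
    have "real n * g y \<le> (\<Sum>k\<in>{1..n}. indicator (G k) y) + 1" if y: "y \<in> topspace Y" for y
    proof -
      have "(\<Sum>k\<in>{1..n}. indicator (G k) y :: real) = real (card {k \<in> {1..n}. real k < real n * g y})"
        using y by (simp add: indicator_def G_def sum.If_cases Int_def)
      moreover have "real n * g y \<le> real n" using g_le[OF y] mult_left_mono[of "g y" 1 "real n"] by simp
      ultimately show ?thesis using le_Suc_card_less[of "real n * g y" n] by linarith
    qed
    then have "(\<integral>y. real n * g y \<partial>\<mu>) \<le> (\<integral>y. (\<Sum>k\<in>{1..n}. indicator (G k) y) + 1 \<partial>\<mu>)"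
      using g_int G_sets by (intro integral_mono) (auto simp: \<mu>D emeasure_eq_measure)
    then show ?thesis by simp
  qed
  also have "\<dots> = (\<Sum>k\<in>{1..n}. measure \<mu> (G k)) + 1"
    using G_sets by (subst Bochner_Integration.integral_add)
      (auto simp: prob_space emeasure_eq_measure)
  also have "\<dots> \<le> (\<Sum>k\<in>{1..n}. measure \<mu> (K k) + e / 2) + 1"
    using K(3) by (intro add_right_mono sum_mono) (smt (verit))
  also have "\<dots> = (\<Sum>k\<in>{1..n}. measure \<mu> (K k)) + real n * (e / 2) + 1"
    by (simp add: sum.distrib)
  \<comment> \<open>Whenever \<open>y\<close> lies in \<open>K k\<close>, the level \<open>k\<close>
    is below \<open>n * F l y\<close>. Hence \<open>y\<close> belongs to at most as many of the sets
    \<open>K k\<close> as there are levels below \<open>n * F l y\<close>.\<close>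
  also have "(\<Sum>k\<in>{1..n}. measure \<mu> (K k)) \<le> real n * (\<integral>y. F l y \<partial>\<mu>)"
  proof -
    have "(\<Sum>k\<in>{1..n}. indicator (K k) y) \<le> real n * F l y" if y: "y \<in> topspace Y" for y
    proof -
      have "(\<Sum>k\<in>{1..n}. indicator (K k) y :: real) = real (card {k \<in> {1..n}. y \<in> K k})"
        by (simp add: indicator_def sum.If_cases Int_def)
      also have "\<dots> \<le> real (card {k \<in> {1..n}. real k < real n * F l y})"
        using K_F by (intro of_nat_mono card_mono) auto
      also have "\<dots> \<le> real n * F l y"
        using nonneg[OF l(1) y] by (intro card_less_le) simp
      finally show ?thesis .
    qed
    then have "(\<integral>y. (\<Sum>k\<in>{1..n}. indicator (K k) y) \<partial>\<mu>) \<le> (\<integral>y. real n * F l y \<partial>\<mu>)"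
      using F_int[OF l(1)] K_sets by (intro integral_mono) (auto simp: \<mu>D emeasure_eq_measure)
    then show ?thesis using K_sets by (simp add: emeasure_eq_measure)
  qed
  finally have "real n * (\<integral>y. g y \<partial>\<mu>) \<le> real n * (\<integral>y. F l y \<partial>\<mu>) + real n * (e / 2) + 1"
    by simp
  also have "\<dots> < real n * ((\<integral>y. F l y \<partial>\<mu>) + e)"
    using n by (simp add: field_simps)
  finally have "(\<integral>y. g y \<partial>\<mu>) < (\<integral>y. F l y \<partial>\<mu>) + e"
    using n by simp
  then show ?thesis using l(1) by (intro bexI[of _ l]) auto
qed

section \<open>Stochastic maps as kernels\<close>

text \<open>This is the universal property of the initial topology. Continuity is tested on the
  generating sets, and once \<open>\<mu>\<close> takes values in \<open>prob_meas Y\<close>, their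
  preimages are the preimages of open \<open>V\<close> under the integral functions.\<close>

lemma continuous_map_vague_iff:
  fixes X :: "'a topology" and Y :: "'b topology"
  shows
  "continuous_map X (vague_topology Y) \<mu> \<longleftrightarrow>
    (\<forall>x\<in>topspace X. \<mu> x \<in> prob_meas Y) \<and>
    (\<forall>\<phi>::'b \<Rightarrow> complex. continuous_map Y euclidean \<phi> \<longrightarrow>
      continuous_map X euclidean (\<lambda>x. \<integral>y. \<phi> y \<partial>\<mu> x))" (is "?L \<longleftrightarrow> ?R")
proof -
  let ?S = "{{\<mu> \<in> prob_meas Y. (\<integral>y. \<phi> y \<partial>\<mu>) \<in> V} | (\<phi> :: 'b \<Rightarrow> complex) V.
        continuous_map Y euclidean \<phi> \<and> open V}"
  \<comment> \<open>The zero function with \<open>V = UNIV\<close> shows that the generating sets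
    cover \<open>prob_meas Y\<close>, so mapping into the carrier means taking regular measures as
    values.\<close>
  have "prob_meas Y \<in> ?S"
    by (intro CollectI exI[of _ "\<lambda>_. 0"] exI[of _ UNIV]) auto
  then have top: "\<Union>?S = prob_meas Y" by blast
  have iff: "?L \<longleftrightarrow> (\<forall>U\<in>?S. openin X (\<mu> -` U \<inter> topspace X)) \<and> \<mu> ` topspace X \<subseteq> prob_meas Y"
    unfolding vague_topology_def continuous_on_generated_topo_iff top by blast
  have pre: "\<mu> -` {\<mu> \<in> prob_meas Y. (\<integral>y. \<phi> y \<partial>\<mu>) \<in> V} \<inter> topspace X =
      {x \<in> topspace X. (\<integral>y. \<phi> y \<partial>\<mu> x) \<in> V}"
    if "\<mu> ` topspace X \<subseteq> prob_meas Y" for \<phi> :: "'b \<Rightarrow> complex" and V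
    using that by auto
  have "(\<forall>U\<in>?S. openin X (\<mu> -` U \<inter> topspace X)) \<longleftrightarrow>
      (\<forall>\<phi>::'b \<Rightarrow> complex. continuous_map Y euclidean \<phi> \<longrightarrow>
        continuous_map X euclidean (\<lambda>x. \<integral>y. \<phi> y \<partial>\<mu> x))"
    if "\<mu> ` topspace X \<subseteq> prob_meas Y"
  proof -
    have "(\<forall>U\<in>?S. openin X (\<mu> -` U \<inter> topspace X)) \<longleftrightarrow>
        (\<forall>\<phi>::'b \<Rightarrow> complex. \<forall>V. continuous_map Y euclidean \<phi> \<and> open V \<longrightarrow>
          openin X (\<mu> -` {\<mu> \<in> prob_meas Y. (\<integral>y. \<phi> y \<partial>\<mu>) \<in> V} \<inter> topspace X))"
      by blast
    then show ?thesis
      unfolding pre[OF that] by (simp add: continuous_map_def) blast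
  qed
  with iff show ?thesis
    by (fold image_subset_iff) argo
qed

text \<open>Real test functions embed into the complex ones, and a complex test function is
  recovered from its real and imaginary parts. Compactness of \<open>Y\<close> makes the test
  functions integrable, so that the integral splits accordingly.\<close>

lemma continuous_map_vague_iff_real:
  fixes X :: "'a topology" and Y :: "'b topology"
  assumes Y: "compact_space Y"
  shows "continuous_map X (vague_topology Y) \<mu> \<longleftrightarrow>
    (\<forall>x\<in>topspace X. \<mu> x \<in> prob_meas Y) \<and>
    (\<forall>\<phi>. continuous_map Y euclideanreal \<phi> \<longrightarrow>
      continuous_map X euclideanreal (\<lambda>x. \<integral>y. \<phi> y \<partial>\<mu> x))" (is "_ \<longleftrightarrow> ?P \<and> ?R")
proof -
  have "?R" if C: "\<And>\<phi>::'b \<Rightarrow> complex. continuous_map Y euclidean \<phi> \<Longrightarrow>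
      continuous_map X euclidean (\<lambda>x. \<integral>y. \<phi> y \<partial>\<mu> x)"
  proof (intro allI impI)
    fix \<phi> assume "continuous_map Y euclideanreal \<phi>"
    then have "continuous_map Y euclidean (\<lambda>y. complex_of_real (\<phi> y))"
      by (rule continuous_map_euclidean_compose[OF _ linear_continuous_on[OF bounded_linear_of_real]])
    then have "continuous_map X euclidean (\<lambda>x. \<integral>y. complex_of_real (\<phi> y) \<partial>\<mu> x)"
      by (rule C)
    then have "continuous_map X euclideanreal (\<lambda>x. Re (\<integral>y. complex_of_real (\<phi> y) \<partial>\<mu> x))"
      by (rule continuous_map_euclidean_compose[OF _ linear_continuous_on[OF bounded_linear_Re]])
    then show "continuous_map X euclideanreal (\<lambda>x. \<integral>y. \<phi> y \<partial>\<mu> x)" by simp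
  qed
  moreover have "continuous_map X euclidean (\<lambda>x. \<integral>y. \<phi> y \<partial>\<mu> x)"
    if P: ?P and R: ?R and \<phi>: "continuous_map Y euclidean \<phi>" for \<phi> :: "'b \<Rightarrow> complex"
  proof (rule continuous_map_eq)
    have "continuous_map Y euclideanreal (\<lambda>y. Re (\<phi> y))"
      "continuous_map Y euclideanreal (\<lambda>y. Im (\<phi> y))"
      using continuous_map_euclidean_compose[OF \<phi> linear_continuous_on[OF bounded_linear_Re]]
        continuous_map_euclidean_compose[OF \<phi> linear_continuous_on[OF bounded_linear_Im]]
      by auto
    then have "continuous_map X euclideanreal (\<lambda>x. \<integral>y. Re (\<phi> y) \<partial>\<mu> x)"
      "continuous_map X euclideanreal (\<lambda>x. \<integral>y. Im (\<phi> y) \<partial>\<mu> x)"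
      using R by auto
    note this[THEN continuous_map_euclidean_compose[OF _ linear_continuous_on[OF bounded_linear_of_real]]]
    from this(1) continuous_map_euclidean_compose[OF this(2), of "\<lambda>z. \<i> * z"]
    show "continuous_map X euclidean
        (\<lambda>x. complex_of_real (\<integral>y. Re (\<phi> y) \<partial>\<mu> x) + \<i> * complex_of_real (\<integral>y. Im (\<phi> y) \<partial>\<mu> x))"
      by (intro continuous_map_add) (auto intro!: continuous_on_mult_left continuous_on_id)
    fix x assume "x \<in> topspace X"
    then have "integrable (\<mu> x) \<phi>"
      using P \<phi> Y by (intro integrable_continuous_map) auto
    then show "complex_of_real (\<integral>y. Re (\<phi> y) \<partial>\<mu> x) + \<i> * complex_of_real (\<integral>y. Im (\<phi> y) \<partial>\<mu> x)
        = (\<integral>y. \<phi> y \<partial>\<mu> x)"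
      by (simp add: complex_eq_iff)
  qed
  ultimately show ?thesis
    unfolding continuous_map_vague_iff by blast
qed

lemma continuous_map_vague_integral:
  fixes \<phi> :: "'b \<Rightarrow> real"
  assumes "compact_space Y" "continuous_map X (vague_topology Y) \<mu>" "continuous_map Y euclidean \<phi>"
  shows "continuous_map X euclidean (\<lambda>x. \<integral>y. \<phi> y \<partial>\<mu> x)"
  using assms by (simp add: continuous_map_vague_iff_real)

context
  fixes Y :: "'b topology" and Z :: "'c topology" and \<nu> :: "'b \<Rightarrow> 'c measure"
  assumes Z: "compact_space Z" "Hausdorff_space Z"
    and \<nu>: "continuous_map Y (vague_topology Z) \<nu>"
begin

lemma vague_prob_meas: "y \<in> topspace Y \<Longrightarrow> \<nu> y \<in> prob_meas Z"
  using \<nu> by (simp add: continuous_map_vague_iff)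

text \<open>Near a point \<open>y0\<close> of the set, pick a compact \<open>K\<close> inside
  \<open>V\<close> with \<open>\<nu> y0\<close> mass above \<open>c\<close>, and a Urysohn function
  \<open>\<phi>\<close> between the indicators of \<open>K\<close> and \<open>V\<close>. The points
  \<open>y\<close> at which the integral of \<open>\<phi>\<close> exceeds \<open>c\<close> form an
  open neighbourhood of \<open>y0\<close>, and there the mass of \<open>V\<close> is at least that
  integral.\<close>

lemma vague_measure_lsc:
  assumes V: "openin Z V"
  shows "openin Y {y \<in> topspace Y. c < measure (\<nu> y) V}"
proof (subst openin_subopen, intro ballI)
  fix y0 assume "y0 \<in> {y \<in> topspace Y. c < measure (\<nu> y) V}"
  then have y0: "y0 \<in> topspace Y" "c < measure (\<nu> y0) V" by auto
  note y0D = prob_measD[OF vague_prob_meas[OF y0(1)]]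
  obtain K where K: "compactin Z K" "K \<subseteq> V" "c < measure (\<nu> y0) K"
    by (rule prob_meas_inner_regular[OF vague_prob_meas[OF y0(1)] openin_imp_sets_borel_on[OF V] y0(2)])
  have "normal_space Z" using Z compact_Hausdorff_or_regular_imp_normal_space by blast
  moreover have "closedin Z K" using K Z compactin_imp_closedin by blast
  ultimately obtain \<phi> where \<phi>: "continuous_map Z (top_of_set {0..1::real}) \<phi>"
    "\<phi> ` (topspace Z - V) \<subseteq> {0}" "\<phi> ` K \<subseteq> {1}"
    using V K(2) by (auto simp: disjnt_def elim!: Urysohn_lemma[of Z "topspace Z - V" K 0 1])
  have \<phi>_cont: "continuous_map Z euclideanreal \<phi>"
    and \<phi>_range: "\<And>z. z \<in> topspace Z \<Longrightarrow> 0 \<le> \<phi> z \<and> \<phi> z \<le> 1"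
    using \<phi>(1) by (auto simp: continuous_map_in_subtopology)
  have \<phi>_le: "(\<integral>z. \<phi> z \<partial>\<nu> y) \<le> measure (\<nu> y) V" if y: "y \<in> topspace Y" for y
  proof -
    note yD = prob_measD[OF vague_prob_meas[OF y]]
    interpret prob_space "\<nu> y" by (rule yD)
    have "(\<integral>z. \<phi> z \<partial>\<nu> y) \<le> (\<integral>z. indicator V z \<partial>\<nu> y)"
    proof (rule integral_mono[OF integrable_continuous_map[OF Z(1) vague_prob_meas[OF y] \<phi>_cont]])
      show "integrable (\<nu> y) (indicator V :: _ \<Rightarrow> real)"
        using V by (simp add: yD openin_imp_sets_borel_on emeasure_eq_measure)
    qed (use \<phi>_range \<phi>(2) in \<open>auto simp: yD indicator_def\<close>)
    then show ?thesis using V by (simp add: yD openin_imp_sets_borel_on emeasure_eq_measure Int_absorb2 openin_subset)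
  qed
  have "measure (\<nu> y0) K \<le> (\<integral>z. \<phi> z \<partial>\<nu> y0)"
  proof -
    interpret prob_space "\<nu> y0" by (rule y0D)
    have Ks: "K \<in> sets (\<nu> y0)" using K Z by (simp add: y0D compactin_imp_sets_borel_on)
    have "(\<integral>z. indicator K z \<partial>\<nu> y0) \<le> (\<integral>z. \<phi> z \<partial>\<nu> y0)"
    proof (rule integral_mono[OF _ integrable_continuous_map[OF Z(1) vague_prob_meas[OF y0(1)] \<phi>_cont]])
      show "integrable (\<nu> y0) (indicator K :: _ \<Rightarrow> real)"
        using Ks by (simp add: emeasure_eq_measure)
    qed (use \<phi>_range \<phi>(3) in \<open>auto simp: y0D indicator_def\<close>)
    then show ?thesis using Ks by (simp add: emeasure_eq_measure)
  qed
  then have "y0 \<in> {y \<in> topspace Y. (\<integral>z. \<phi> z \<partial>\<nu> y) \<in> {c<..}}"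
    using K(3) y0 by auto
  moreover have "openin Y {y \<in> topspace Y. (\<integral>z. \<phi> z \<partial>\<nu> y) \<in> {c<..}}"
    by (intro openin_continuous_map_preimage[OF continuous_map_vague_integral[OF Z(1) \<nu> \<phi>_cont]]) auto
  moreover have "{y \<in> topspace Y. (\<integral>z. \<phi> z \<partial>\<nu> y) \<in> {c<..}} \<subseteq> {y \<in> topspace Y. c < measure (\<nu> y) V}"
    using \<phi>_le by (force intro: less_le_trans)
  ultimately show "\<exists>T. openin Y T \<and> y0 \<in> T \<and> T \<subseteq> {y \<in> topspace Y. c < measure (\<nu> y) V}"
    by blast
qed

text \<open>The open sets form an intersection-stable generator of the Borel sets, so measurability
  of evaluation need only be checked on them, where it follows from lower semicontinuity.\<close>

lemma vague_kernel: "\<nu> \<in> measurable (borel_on Y) (subprob_algebra (borel_on Z))"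
proof (rule measurable_subprob_algebra_generated[OF sets_borel_on])
  show "Int_stable {U. openin Z U}" by (auto simp: Int_stable_def)
  show "{U. openin Z U} \<subseteq> Pow (topspace Z)" by (auto dest: openin_subset)
  show "subprob_space (\<nu> a)" "sets (\<nu> a) = sets (borel_on Z)" if "a \<in> space (borel_on Y)" for a
    using prob_measD[OF vague_prob_meas] that by (auto intro: prob_space_imp_subprob_space)
  have *: "(\<lambda>a. emeasure (\<nu> a) A) \<in> borel_measurable (borel_on Y)" if A: "openin Z A" for A
  proof -
    have "(\<lambda>a. measure (\<nu> a) A) \<in> borel_measurable (borel_on Y)"
      by (rule borel_measurableI_greater) (simp add: openin_imp_sets_borel_on vague_measure_lsc A)
    then have "(\<lambda>a. ennreal (measure (\<nu> a) A)) \<in> borel_measurable (borel_on Y)" by measurable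
    moreover have "emeasure (\<nu> a) A = ennreal (measure (\<nu> a) A)" if "a \<in> space (borel_on Y)" for a
      using prob_measD(1)[OF vague_prob_meas] that
      by (auto intro: finite_measure.emeasure_eq_measure prob_space.finite_measure)
    ultimately show ?thesis by (subst measurable_cong) auto
  qed
  then show "A \<in> {U. openin Z U} \<Longrightarrow> (\<lambda>a. emeasure (\<nu> a) A) \<in> borel_measurable (borel_on Y)" for A
    by simp
  show "(\<lambda>a. emeasure (\<nu> a) (topspace Z)) \<in> borel_measurable (borel_on Y)"
    by (rule *) simp
qed

section \<open>Composition as a bind of kernels, and its regularity\<close>

context
  fixes \<mu> :: "'b measure"
  assumes Y: "Hausdorff_space Y" and \<mu>: "\<mu> \<in> prob_meas Y"
begin

lemma kernel_on_prob_meas: "\<nu> \<in> measurable \<mu> (subprob_algebra (borel_on Z))"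
  using vague_kernel prob_measD(4)[OF \<mu>] by metis

lemma sets_bind_prob_meas: "sets (\<mu> \<bind> \<nu>) = sets (borel_on Z)"
  using prob_measD(2)[OF vague_prob_meas] prob_measD(3)[OF \<mu>]
    prob_space.not_empty[OF prob_measD(1)[OF \<mu>]]
  by (intro sets_bind) auto

lemma measure_bind_prob_meas:
  "E \<in> sets (borel_on Z) \<Longrightarrow> measure (\<mu> \<bind> \<nu>) E = (\<integral>y. measure (\<nu> y) E \<partial>\<mu>)"
  using prob_measD(1)[OF \<mu>] kernel_on_prob_meas
  by (intro subprob_space.measure_bind prob_space_imp_subprob_space)

text \<open>This rules out the default value of \<open>measure_of\<close> in
  \<open>stoch_comp\<close>: on Borel sets the integral formula agrees with a genuine measure,
  namely the bind.\<close>

lemma bind_eq_measure_of: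
  "\<mu> \<bind> \<nu> = measure_of (topspace Z) (sets (borel_on Z)) (\<lambda>E. ennreal (\<integral>y. measure (\<nu> y) E \<partial>\<mu>))"
proof -
  interpret B: subprob_space "\<mu> \<bind> \<nu>"
    using prob_measD(1)[OF \<mu>] kernel_on_prob_meas
    by (intro subprob_space_bind prob_space_imp_subprob_space)
  have "\<mu> \<bind> \<nu> = measure_of (space (\<mu> \<bind> \<nu>)) (sets (\<mu> \<bind> \<nu>)) (emeasure (\<mu> \<bind> \<nu>))"
    by (rule measure_of_of_measure[symmetric])
  also have "space (\<mu> \<bind> \<nu>) = topspace Z"
    using sets_eq_imp_space_eq[OF sets_bind_prob_meas] by simp
  also have "sets (\<mu> \<bind> \<nu>) = sets (borel_on Z)"
    by (rule sets_bind_prob_meas)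
  also have "measure_of (topspace Z) (sets (borel_on Z)) (emeasure (\<mu> \<bind> \<nu>)) =
      measure_of (topspace Z) (sets (borel_on Z)) (\<lambda>E. ennreal (\<integral>y. measure (\<nu> y) E \<partial>\<mu>))"
  proof (rule measure_of_eq)
    show "sets (borel_on Z) \<subseteq> Pow (topspace Z)"
      using sets.space_closed[of "borel_on Z"] by simp
    fix E assume "E \<in> sigma_sets (topspace Z) (sets (borel_on Z))"
    then have "E \<in> sets (borel_on Z)"
      using sets.sigma_sets_eq[of "borel_on Z"] by simp
    then show "emeasure (\<mu> \<bind> \<nu>) E = ennreal (\<integral>y. measure (\<nu> y) E \<partial>\<mu>)"
      by (simp add: B.emeasure_eq_measure measure_bind_prob_meas)
  qed
  finally show ?thesis .
qed

lemma bind_in_prob_meas: "\<mu> \<bind> \<nu> \<in> prob_meas Z"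
proof (rule prob_measI_inner_open[OF Z])
  interpret prob_space \<mu> by (rule prob_measD[OF \<mu>])
  show ps: "prob_space (\<mu> \<bind> \<nu>)"
    using prob_measD(1)[OF vague_prob_meas] prob_measD(3)[OF \<mu>]
    by (intro prob_space_bind[OF _ kernel_on_prob_meas]) auto
  show sets: "sets (\<mu> \<bind> \<nu>) = sets (borel_on Z)" by (rule sets_bind_prob_meas)
  interpret B: prob_space "\<mu> \<bind> \<nu>" by fact
  fix U and e :: real assume U: "openin Z U" and e: "e > 0"
  \<comment> \<open>The closures supply the closed sets needed for inner regularity. The family is
    directed under union because the closure of \<open>V \<union> W\<close> is the union of the two
    closures.\<close>
  define I where "I = {V. openin Z V \<and> Z closure_of V \<subseteq> U}"
  have in_U: "V \<subseteq> U" if "V \<in> I" for V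
    using that closure_of_subset[OF openin_subset, of Z V] by (auto simp: I_def)
  have mono: "measure (\<nu> y) V \<le> measure (\<nu> y) W"
    if "y \<in> topspace Y" "V \<subseteq> W" "W \<in> sets (borel_on Z)" for y V W
    using that prob_measD[OF vague_prob_meas[OF that(1)]]
    by (intro finite_measure.finite_measure_mono prob_space.finite_measure) auto
  have "\<exists>V\<in>I. (\<integral>y. measure (\<nu> y) U \<partial>\<mu>) - e < (\<integral>y. measure (\<nu> y) V \<partial>\<mu>)"
  proof (rule prob_meas_directed_sup[OF \<mu> Y])
    show "I \<noteq> {}" by (auto simp: I_def intro!: exI[of _ "{}"])
    show "\<exists>T\<in>I. \<forall>y\<in>topspace Y. measure (\<nu> y) V \<le> measure (\<nu> y) T \<and> measure (\<nu> y) W \<le> measure (\<nu> y) T"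
      if "V \<in> I" "W \<in> I" for V W
      using that
      by (intro bexI[of _ "V \<union> W"]) (auto simp: I_def intro!: mono openin_imp_sets_borel_on)
    show "openin Y {y \<in> topspace Y. c < measure (\<nu> y) V}" if "V \<in> I" for V c
      using that by (intro vague_measure_lsc) (auto simp: I_def)
    show "measure (\<nu> y) V \<le> measure (\<nu> y) U" if "V \<in> I" "y \<in> topspace Y" for V y
      using that in_U U by (intro mono openin_imp_sets_borel_on)
    show "measure (\<nu> y) U \<le> 1" if "y \<in> topspace Y" for y
      using prob_measD(1)[OF vague_prob_meas[OF that]] by (rule prob_space.prob_le_1)
    show "\<exists>V\<in>I. c < measure (\<nu> y) V" if y: "y \<in> topspace Y" and c: "c < measure (\<nu> y) U" for y c
    proof -
      obtain K where K: "compactin Z K" "K \<subseteq> U" "c < measure (\<nu> y) K"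
        by (rule prob_meas_inner_regular[OF vague_prob_meas[OF y] openin_imp_sets_borel_on[OF U] c])
      have "normal_space Z" using Z compact_Hausdorff_or_regular_imp_normal_space by blast
      moreover have "closedin Z K" using K Z compactin_imp_closedin by blast
      \<comment> \<open>Normality interpolates an open set and its closure between the compact
        \<open>K\<close> and \<open>U\<close>; this \<open>V\<close> has at least the mass of
        \<open>K\<close>.\<close>
      ultimately have "\<exists>V. openin Z V \<and> K \<subseteq> V \<and> Z closure_of V \<subseteq> U"
        using U K(2) by (simp add: normal_space_alt)
      then obtain V where V: "openin Z V" "K \<subseteq> V" "Z closure_of V \<subseteq> U" by blast
      then show ?thesis
        using K(3) mono[OF y V(2) openin_imp_sets_borel_on[OF V(1)]]
        by (intro bexI[of _ V]) (auto simp: I_def)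
    qed
  qed (use e in auto)
  then obtain V where V: "V \<in> I" "(\<integral>y. measure (\<nu> y) U \<partial>\<mu>) - e < (\<integral>y. measure (\<nu> y) V \<partial>\<mu>)"
    by blast
  have "openin Z V" using V by (simp add: I_def)
  have "measure (\<mu> \<bind> \<nu>) U - e < measure (\<mu> \<bind> \<nu>) V"
    using V(2) U \<open>openin Z V\<close> by (simp add: measure_bind_prob_meas openin_imp_sets_borel_on)
  also have "\<dots> \<le> measure (\<mu> \<bind> \<nu>) (Z closure_of V)"
    using \<open>openin Z V\<close>
    by (intro B.finite_measure_mono closure_of_subset)
       (auto simp: sets closedin_imp_sets_borel_on dest: openin_subset)
  finally show "\<exists>C. closedin Z C \<and> C \<subseteq> U \<and> measure (\<mu> \<bind> \<nu>) U - e < measure (\<mu> \<bind> \<nu>) C"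
    using V(1) by (intro exI[of _ "Z closure_of V"]) (auto simp: I_def)
qed

text \<open>This reduces vague continuity of a composite to that of its factors. Boundedness of
  \<open>\<phi>\<close> and total mass 1 of each \<open>\<nu> y\<close> justify the iterated
  integral.\<close>

lemma integral_bind_prob_meas:
  assumes \<phi>: "continuous_map Z euclideanreal \<phi>"
  shows "(\<integral>z. \<phi> z \<partial>(\<mu> \<bind> \<nu>)) = (\<integral>y. (\<integral>z. \<phi> z \<partial>\<nu> y) \<partial>\<mu>)"
proof -
  interpret prob_space \<mu> by (rule prob_measD[OF \<mu>])
  obtain B where B: "\<And>z. z \<in> topspace Z \<Longrightarrow> norm (\<phi> z) \<le> B"
    by (rule continuous_map_imp_norm_bounded[OF Z(1) \<phi>]) blast
  have "emeasure (\<nu> y) (space (\<nu> y)) \<le> ennreal 1" if "y \<in> space \<mu>" for y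
    using that prob_measD(3)[OF \<mu>]
      prob_space.emeasure_space_1[OF prob_measD(1)[OF vague_prob_meas, of y]]
    by simp
  then show ?thesis
    using B by (intro integral_bind[where K = "borel_on Z" and B = B and B' = 1]
        continuous_map_imp_borel_measurable \<phi> kernel_on_prob_meas)
      (auto intro: finite_measure_axioms)
qed

end

end

section \<open>Composites of stochastic maps are stochastic maps\<close>

lemma stoch_mapsD:
  assumes "\<mu> \<in> stoch_maps X Y"
  shows "\<mu> \<in> extensional (topspace X)" "continuous_map X (vague_topology Y) \<mu>"
    "x \<in> topspace X \<Longrightarrow> \<mu> x \<in> prob_meas Y"
  using assms by (auto simp: stoch_maps_def continuous_map_vague_iff)

lemma stoch_comp_eq_bind:
  assumes "Hausdorff_space Y" "compact_space Z" "Hausdorff_space Z"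
    and "\<mu> \<in> stoch_maps X Y" "\<nu> \<in> stoch_maps Y Z"
  shows "stoch_comp X Y Z \<mu> \<nu> = (\<lambda>x\<in>topspace X. \<mu> x \<bind> \<nu>)"
  unfolding stoch_comp_def
  using assms by (intro restrict_ext bind_eq_measure_of[symmetric]) (auto dest: stoch_mapsD)

text \<open>Averaging a test function on \<open>Z\<close> over \<open>\<nu>\<close> gives a
  continuous function on \<open>Y\<close>, which is therefore a legitimate test function for
  \<open>\<mu>\<close>. Averaging again yields the integral against the composite, which is thus
  continuous in \<open>x\<close>.\<close>

lemma stoch_comp_in_stoch_maps:
  assumes Y: "compact_space Y" "Hausdorff_space Y" and Z: "compact_space Z" "Hausdorff_space Z"
    and \<mu>: "\<mu> \<in> stoch_maps X Y" and \<nu>: "\<nu> \<in> stoch_maps Y Z"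
  shows "stoch_comp X Y Z \<mu> \<nu> \<in> stoch_maps X Z"
proof -
  have "continuous_map X (vague_topology Z) (\<lambda>x\<in>topspace X. \<mu> x \<bind> \<nu>)"
    unfolding continuous_map_vague_iff_real[OF Z(1)]
  proof (intro conjI ballI allI impI)
    fix x assume "x \<in> topspace X"
    then show "(\<lambda>x\<in>topspace X. \<mu> x \<bind> \<nu>) x \<in> prob_meas Z"
      using stoch_mapsD[OF \<mu>] stoch_mapsD[OF \<nu>] Y Z by (auto intro: bind_in_prob_meas)
  next
    fix \<phi> assume \<phi>: "continuous_map Z euclideanreal \<phi>"
    then have "continuous_map Y euclideanreal (\<lambda>y. \<integral>z. \<phi> z \<partial>\<nu> y)"
      using stoch_mapsD(2)[OF \<nu>] by (intro continuous_map_vague_integral[OF Z(1)])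
    then have "continuous_map X euclideanreal (\<lambda>x. \<integral>y. (\<integral>z. \<phi> z \<partial>\<nu> y) \<partial>\<mu> x)"
      using stoch_mapsD(2)[OF \<mu>] by (intro continuous_map_vague_integral[OF Y(1)])
    then show "continuous_map X euclideanreal (\<lambda>x. \<integral>z. \<phi> z \<partial>(\<lambda>x\<in>topspace X. \<mu> x \<bind> \<nu>) x)"
      by (rule continuous_map_eq)
         (use stoch_mapsD[OF \<mu>] stoch_mapsD[OF \<nu>] Y Z \<phi> in \<open>auto simp: integral_bind_prob_meas\<close>)
  qed
  then show ?thesis
    using assms by (simp add: stoch_comp_eq_bind stoch_maps_def)
qed

section \<open>Dirac measures\<close>

lemma return_in_prob_meas:
  assumes Y: "compact_space Y" "Hausdorff_space Y" and y: "y \<in> topspace Y"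
  shows "return (borel_on Y) y \<in> prob_meas Y"
proof (rule prob_measI_inner_open[OF Y])
  show "prob_space (return (borel_on Y) y)"
    using y by (intro prob_space_return) simp
  fix U and e :: real assume U: "openin Y U" and e: "e > 0"
  have sing: "closedin Y {y}"
    using Y y by (simp add: closedin_Hausdorff_sing_eq)
  show "\<exists>C. closedin Y C \<and> C \<subseteq> U \<and>
      measure (return (borel_on Y) y) U - e < measure (return (borel_on Y) y) C"
    \<comment> \<open>If \<open>y\<close> lies in \<open>U\<close>, the closed set
      \<open>{y}\<close> carries all the mass; otherwise \<open>U\<close> is null and the empty set
      suffices.\<close>
    by (rule exI[of _ "if y \<in> U then {y} else {}"])
       (use e U sing in \<open>auto simp: measure_return openin_imp_sets_borel_on closedin_imp_sets_borel_on\<close>)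
qed simp

text \<open>Integration against the Dirac measure at \<open>f x\<close> is evaluation, so continuity
  of the integrals is continuity of the test function composed with \<open>f\<close>.\<close>

lemma dirac_map_in_stoch_maps:
  assumes Y: "compact_space Y" "Hausdorff_space Y" and f: "continuous_map X Y f"
  shows "dirac_map X Y f \<in> stoch_maps X Y"
proof -
  have fY: "f x \<in> topspace Y" if "x \<in> topspace X" for x
    using f that by (auto simp: continuous_map_def)
  have "continuous_map X (vague_topology Y) (dirac_map X Y f)"
    unfolding continuous_map_vague_iff_real[OF Y(1)]
  proof (intro conjI ballI allI impI)
    show "dirac_map X Y f x \<in> prob_meas Y" if "x \<in> topspace X" for x
      using that Y fY by (simp add: dirac_map_def return_in_prob_meas)
    fix \<phi> assume \<phi>: "continuous_map Y euclideanreal \<phi>"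
    have "continuous_map X euclideanreal (\<lambda>x. \<phi> (f x))"
      using continuous_map_compose[OF f \<phi>] by (simp add: o_def)
    then show "continuous_map X euclideanreal (\<lambda>x. \<integral>y. \<phi> y \<partial>dirac_map X Y f x)"
      by (rule continuous_map_eq)
         (use fY \<phi> in \<open>simp add: dirac_map_def integral_return continuous_map_imp_borel_measurable\<close>)
  qed
  then show ?thesis by (simp add: stoch_maps_def dirac_map_def)
qed

text \<open>Points are closed, hence Borel, and \<open>{y}\<close> separates the two measures: the
  Dirac measure at \<open>z\<close> gives it mass 1 only if \<open>z = y\<close>.\<close>

lemma return_borel_on_inject:
  assumes "Hausdorff_space Y" "y \<in> topspace Y" "return (borel_on Y) y = return (borel_on Y) z"
  shows "y = z"
proof -
  have sing: "{y} \<in> sets (borel_on Y)"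
    using assms by (intro closedin_imp_sets_borel_on) (simp add: closedin_Hausdorff_sing_eq)
  have "measure (return (borel_on Y) y) {y} = measure (return (borel_on Y) z) {y}"
    using assms(3) by simp
  then show ?thesis
    using sing by (simp add: measure_return indicator_def split: if_splits)
qed

section \<open>The two categories and the Dirac functor\<close>

lemma cHaus_sel [simp]:
  "Ob cHaus = {X. compact_space X \<and> Hausdorff_space X}"
  "Hom cHaus X Y = {f \<in> extensional (topspace X). continuous_map X Y f}"
  "Id cHaus X = (\<lambda>x\<in>topspace X. x)"
  "Comp cHaus X Y Z f g = compose (topspace X) g f"
  by (simp_all add: cHaus_def)

text \<open>Writing the identity as a \<open>dirac_map\<close> lets
  \<open>dirac_map_in_stoch_maps\<close> show that it is a stochastic map.\<close>

lemma cHausStoch_sel [simp]: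
  "Ob cHausStoch = {X. compact_space X \<and> Hausdorff_space X}"
  "Hom cHausStoch X Y = stoch_maps X Y"
  "Id cHausStoch X = dirac_map X X (\<lambda>x. x)"
  "Comp cHausStoch X Y Z f g = stoch_comp X Y Z f g"
  by (simp_all add: cHausStoch_def dirac_map_def)

lemma category_cHaus: "category cHaus"
proof (unfold_locales, goal_cases)
  case (1 X)
  then show ?case by (auto intro: continuous_map_eq[of _ _ "\<lambda>x. x"])
next
  case (2 X Y Z f g)
  then show ?case
    by (auto intro: continuous_map_eq[OF continuous_map_compose] simp: compose_def)
next
  case (3 X Y f)
  then show ?case by (auto simp: compose_def extensional_def fun_eq_iff)
next
  case (4 X Y f)
  then show ?case by (auto simp: compose_def extensional_def fun_eq_iff continuous_map_def Pi_iff)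
next
  case (5 W X Y Z f g h)
  then show ?case by (auto simp: compose_def fun_eq_iff continuous_map_def Pi_iff)
qed

lemma category_cHausStoch: "category cHausStoch"
proof (unfold_locales, goal_cases)
  case (1 X)
  then show ?case by (auto intro: dirac_map_in_stoch_maps)
next
  case (2 X Y Z \<mu> \<nu>)
  then show ?case by (auto intro: stoch_comp_in_stoch_maps)
next
  case (3 X Y \<mu>)
  then have Id: "dirac_map X X (\<lambda>x. x) \<in> stoch_maps X X"
    by (auto intro: dirac_map_in_stoch_maps)
  have "return (borel_on X) x \<bind> \<mu> = \<mu> x" if "x \<in> topspace X" for x
    using 3 that by (intro bind_return[OF vague_kernel[where Z = Y]]) (auto dest: stoch_mapsD)
  then show ?case
    using 3 Id by (auto simp: stoch_comp_eq_bind dirac_map_def fun_eq_iff extensional_def dest: stoch_mapsD(1))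
next
  case (4 X Y \<mu>)
  then have Id: "dirac_map Y Y (\<lambda>x. x) \<in> stoch_maps Y Y"
    by (auto intro: dirac_map_in_stoch_maps)
  have "\<mu> x \<bind> dirac_map Y Y (\<lambda>x. x) = \<mu> x" if "x \<in> topspace X" for x
  proof -
    have D: "sets (\<mu> x) = sets (borel_on Y)" "space (\<mu> x) = topspace Y"
      using 4 that by (auto dest: stoch_mapsD(3) prob_measD)
    \<comment> \<open>\<open>return\<close> depends only on the sigma-algebra of its measure
      argument, so \<open>borel_on Y\<close> may be replaced by \<open>\<mu> x\<close>, the form
      required by the right unit law of the monad.\<close>
    have "\<mu> x \<bind> dirac_map Y Y (\<lambda>x. x) = \<mu> x \<bind> return (\<mu> x)"
      using D by (intro bind_cong) (auto simp: dirac_map_def intro: fun_cong[OF return_sets_cong])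
    then show ?thesis by (simp add: bind_return')
  qed
  then show ?case
    using 4 Id by (auto simp: stoch_comp_eq_bind fun_eq_iff extensional_def dest: stoch_mapsD(1))
next
  case (5 W X Y Z \<kappa> \<mu> \<nu>)
  have "(\<kappa> w \<bind> \<mu>) \<bind> \<nu> = \<kappa> w \<bind> (\<lambda>x\<in>topspace X. \<mu> x \<bind> \<nu>)" if "w \<in> topspace W" for w
  proof -
    have w: "\<kappa> w \<in> prob_meas X"
      using 5 that by (auto dest: stoch_mapsD)
    have "(\<kappa> w \<bind> \<mu>) \<bind> \<nu> = \<kappa> w \<bind> (\<lambda>x. \<mu> x \<bind> \<nu>)"
    proof (rule bind_assoc)
      show "\<mu> \<in> measurable (\<kappa> w) (subprob_algebra (borel_on Y))"
        using 5 w by (intro kernel_on_prob_meas[where Y = X and Z = Y]) (auto dest: stoch_mapsD)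
      show "\<nu> \<in> measurable (borel_on Y) (subprob_algebra (borel_on Z))"
        using 5 by (intro vague_kernel[where Z = Z]) (auto dest: stoch_mapsD)
    qed
    \<comment> \<open>A bind sees its kernel only on the space of \<open>\<kappa> w\<close>, which
      is \<open>topspace X\<close>, so restricting the inner composite changes nothing.\<close>
    also have "\<dots> = \<kappa> w \<bind> (\<lambda>x\<in>topspace X. \<mu> x \<bind> \<nu>)"
      using prob_measD(3)[OF w] by (intro bind_cong) auto
    finally show ?thesis .
  qed
  moreover have "stoch_comp W X Y \<kappa> \<mu> \<in> stoch_maps W Y" "stoch_comp X Y Z \<mu> \<nu> \<in> stoch_maps X Z"
    using 5 by (auto intro: stoch_comp_in_stoch_maps)
  ultimately show ?case
    using 5 by (auto simp: stoch_comp_eq_bind)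
qed

text \<open>Preservation of composition is the left unit law of the monad: binding the Dirac measure
  at \<open>f x\<close> with the kernel of \<open>g\<close> evaluates that kernel at
  \<open>f x\<close>.\<close>

lemma functor_dirac_map: "category_functor cHaus cHausStoch (\<lambda>X. X) dirac_map"
proof -
  interpret C: category cHaus by (rule category_cHaus)
  interpret D: category cHausStoch by (rule category_cHausStoch)
  show ?thesis
  proof (unfold_locales, goal_cases)
    case (1 X)
    then show ?case by simp
  next
    case (2 X Y f)
    then show ?case by (auto intro: dirac_map_in_stoch_maps)
  next
    case (3 X)
    then show ?case by (auto simp: dirac_map_def)
  next
    case (4 X Y Z f g)
    then have S: "dirac_map X Y f \<in> stoch_maps X Y" "dirac_map Y Z g \<in> stoch_maps Y Z"
      by (auto intro: dirac_map_in_stoch_maps)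
    have fY: "f x \<in> topspace Y" if "x \<in> topspace X" for x
      using 4 that by (auto simp: continuous_map_def)
    have "return (borel_on Y) (f x) \<bind> dirac_map Y Z g = dirac_map Y Z g (f x)"
      if "x \<in> topspace X" for x
      using 4 that fY stoch_mapsD[OF S(2)] by (intro bind_return[OF vague_kernel[where Z = Z]]) auto
    then show ?case
      using 4 S fY by (auto simp: stoch_comp_eq_bind fun_eq_iff compose_def dirac_map_def)
  qed
qed

lemma faithful_dirac_map: "faithful_functor cHaus cHausStoch (\<lambda>X. X) dirac_map"
  unfolding faithful_functor_def
proof (intro conjI ballI functor_dirac_map inj_onI)
  fix X Y :: "'a topology" and f g
  assume Y: "Y \<in> Ob cHaus" and fg: "f \<in> Hom cHaus X Y" "g \<in> Hom cHaus X Y"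
    and eq: "dirac_map X Y f = dirac_map X Y g"
  show "f = g"
  proof (rule extensionalityI[of _ "topspace X"])
    fix x assume x: "x \<in> topspace X"
    have "return (borel_on Y) (f x) = return (borel_on Y) (g x)"
      using fun_cong[OF eq, of x] x by (simp add: dirac_map_def)
    moreover have "f x \<in> topspace Y"
      using fg x by (auto simp: continuous_map_def)
    ultimately show "f x = g x"
      using Y by (auto intro: return_borel_on_inject)
  qed (use fg in auto)
qed

text \<open>Two distinct elements are required because on a space with at most one point every
  probability measure on the Borel sets is a Dirac measure. With two points, a measure can give
  \<open>{a}\<close> mass 1/2, whereas Dirac measures only take the values 0 and 1.\<close>

lemma not_full_dirac_map:
  fixes a b :: 'a
  assumes "a \<noteq> b"
  shows "\<not> full_functor (cHaus :: ('a topology, 'a \<Rightarrow> 'a) cat_data) cHausStoch (\<lambda>X. X) dirac_map"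
proof
  define X where "X = discrete_topology {a}"
  define Y where "Y = discrete_topology {a, b}"
  define \<rho> where "\<rho> = uniform_count_measure {a, b}"
  assume full: "full_functor (cHaus :: ('a topology, 'a \<Rightarrow> 'a) cat_data) cHausStoch (\<lambda>X. X) dirac_map"
  have Y: "compact_space Y" "Hausdorff_space Y" and X: "compact_space X" "Hausdorff_space X"
    by (auto simp: X_def Y_def compact_space_discrete_topology)
  have sets_Y: "sets (borel_on Y) = Pow {a, b}"
    using openin_imp_sets_borel_on[of Y] sets.space_closed[of "borel_on Y"] by (auto simp: Y_def)
  have "\<rho> \<in> prob_meas Y"
  proof (rule prob_measI_inner_open[OF Y])
    show "prob_space \<rho>"
      unfolding \<rho>_def by (rule prob_space_uniform_count_measure) auto
    show "sets \<rho> = sets (borel_on Y)"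
      by (simp add: \<rho>_def sets_uniform_count_measure sets_Y)
    fix U and e :: real assume "openin Y U" "e > 0"
    \<comment> \<open>In a discrete space \<open>U\<close> is itself closed and can serve as its own
      inner approximation.\<close>
    then show "\<exists>C. closedin Y C \<and> C \<subseteq> U \<and> measure \<rho> U - e < measure \<rho> C"
      by (intro exI[of _ U]) (auto simp: Y_def)
  qed
  then have "(\<lambda>x\<in>topspace X. \<rho>) \<in> stoch_maps X Y"
    by (auto simp: stoch_maps_def continuous_map_vague_iff X_def)
  then have "(\<lambda>x\<in>topspace X. \<rho>) \<in> dirac_map X Y ` Hom cHaus X Y"
    using full X Y by (auto simp: full_functor_def)
  then obtain f where f: "(\<lambda>x\<in>topspace X. \<rho>) = dirac_map X Y f" by blast
  have "\<rho> = return (borel_on Y) (f a)"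
    using fun_cong[OF f, of a] by (simp add: dirac_map_def X_def)
  then have "measure \<rho> {a} = indicator {a} (f a)"
    by (simp add: measure_return sets_Y)
  moreover have "measure \<rho> {a} = 1 / 2"
    using assms by (simp add: \<rho>_def measure_uniform_count_measure)
  ultimately show False by (cases "f a = a") auto
qed

theorem theorem4p102:
  "category (cHausStoch :: ('a topology, 'a \<Rightarrow> 'a measure) cat_data) \<and>
   category_functor (cHaus :: ('a topology, 'a \<Rightarrow> 'a) cat_data) cHausStoch (\<lambda>X. X) dirac_map \<and>
   faithful_functor (cHaus :: ('a topology, 'a \<Rightarrow> 'a) cat_data) cHausStoch (\<lambda>X. X) dirac_map \<and>
   ((\<exists>a b :: 'a. a \<noteq> b) \<longrightarrow>
     \<not> full_functor (cHaus :: ('a topology, 'a \<Rightarrow> 'a) cat_data) cHausStoch (\<lambda>X. X) dirac_map)"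
  by (intro conjI impI category_cHausStoch functor_dirac_map faithful_dirac_map)
     (elim exE, rule not_full_dirac_map)

end
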